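(* Let $L\subset\mathbb{R}^n$ be a polygonal line with $k+1$ intervals and with vectors of slopes $(a_{i,1},\dots,a_{i,n})$, $0\le i\le k$. Then $L$ has (i) always a tropical rational parametrisation; (ii) a tropical polynomial parametrisation if and only if $a_{i,j}\ge 0$ for $0\le i\le k$, $1\le j\le n$, and $a_{i,j}=0$ implies $a_{l,j}=0$ for all $l\ge i$; (iii) a tropical Laurent polynomial parametrisation if and only if - $a_{i,j}<0$ implies $a_{i+1,j}<0$; - $a_{i+1,j}>0$ implies $a_{i,j}>0$; - $a_{i,j_0}>0$, $a_{i+1,j_0}>0$, $a_{i,j}<0$, $a_{i+1,j}<0$ imply $a_{i,j_0}/a_{i,j}\le a_{i+1,j_0}/a_{i+1,j}$ for all $0\le i\le k-1$, $1\le j\ne j_0\le n$.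
   Context: A polygonal line $L\subset\mathbb{R}^n$ with $k+1$ intervals is a sequence of intervals with endpoints $v_1,\dots,v_k\in\mathbb{Q}^n$ such that for $1\le i\le k-1$ the $i$-th interval has endpoints $v_i,v_{i+1}$, the unbounded $0$-th interval (a ray) has $v_1$ as its right endpoint, and the unbounded $k$-th interval (a ray) has $v_k$ as its left endpoint. It is supposed without loss of generality that no $v_i$ can be discarded while keeping $L$ a polygonal line. The vector of slopes of the $i$-th interval, $1\le i\le k-1$, is $(a_{i,1},\dots,a_{i,n}):=v_{i+1}-v_i$; similarly, for the $0$-th interval it is a direction vector of the ray pointing towards $v_1$, and for the $k$-th interval a direction vector of the ray pointing away from $v_k$; these two vectors are also assumed rational. Vectors of slopes are determined up to a positive factor. A tropical rational function is a continuous piecewise linear function $\mathbb{R}\to\mathbb{R}$ with finitely many linear pieces, all with integer slopes. A tropical polynomial (respectively, tropical Laurent polynomial) is a minimum of finitely many functions $it+a_i$ with $a_i\in\mathbb{R}$ and integers $i\ge 0$ (respectively, arbitrary integers $i$). A tropical root is a point of non-differentiability. Tropical rational functions $f_1,\dots,f_n$ in one variable $t$ provide a tropical rational parametrisation of $L$ if the map $F=(f_1,\dots,f_n):\mathbb{R}\to L$ is a bijection and $F^{-1}(v_i)<F^{-1}(v_{i+1})$ for $1\le i\le k-1$; in particular, the points $F^{-1}(v_1),\dots,F^{-1}(v_k)$ are exactly the points at which one of $f_1,\dots,f_n$ is not differentiable. It is a tropical polynomial (respectively, Laurent polynomial) parametrisation if $f_1,\dots,f_n$ are tropical polynomials (respectively,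 tropical Laurent polynomials).
   Formalization: Polygonal lines are assumed not to meet themselves (otherwise no bijection R→L exists and (i) fails), and a parametrisation must run along both rays in their given direction (otherwise (ii) fails for k=1, where the order condition is empty). *)

theory Defs
  imports "HOL-Analysis.Analysis"
begin

text \<open>
  The data of a polygonal line with vertices \<open>v\<^sub>1, \<dots>, v\<^sub>k\<close>: only the values \<open>vertex L i\<close> with
  \<open>1 \<le> i \<le> k\<close> matter. \<open>init_dir\<close> directs the 0-th interval (a ray) towards \<open>v\<^sub>1\<close>,
  \<open>final_dir\<close> directs the \<open>k\<close>-th interval (a ray) away from \<open>v\<^sub>k\<close>.
\<close>

record 'n polyline =
  nverts :: nat
  vertex :: "nat \<Rightarrow> real ^ 'n"
  init_dir :: "real ^ 'n"
  final_dir :: "real ^ 'n"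

definition rational_vector :: "real ^ 'n \<Rightarrow> bool" where
  "rational_vector x \<longleftrightarrow> (\<forall>j. x $ j \<in> \<rat>)"

definition interval_of :: "'n::finite polyline \<Rightarrow> nat \<Rightarrow> (real ^ 'n) set" where
  "interval_of L i =
     (if i = 0 then {vertex L 1 - s *\<^sub>R init_dir L | s. 0 \<le> s}
      else if i = nverts L then {vertex L i + s *\<^sub>R final_dir L | s. 0 \<le> s}
      else closed_segment (vertex L i) (vertex L (i + 1)))"

definition carrier_of :: "'n::finite polyline \<Rightarrow> (real ^ 'n) set" where
  "carrier_of L = (\<Union>i\<le>nverts L. interval_of L i)"

definition direction :: "'n::finite polyline \<Rightarrow> nat \<Rightarrow> real ^ 'n" where
  "direction L i =
     (if i = 0 then init_dir L
      else if i = nverts L then final_dir L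
      else vertex L (i + 1) - vertex L i)"

text \<open>
  The disjointness condition says that the line does not cross or retrace itself: two
  intervals meet only if they are consecutive, and then only in their common vertex. Without
  it there need not be any bijection from the reals to the line.

  The last condition says that no vertex can be discarded. Discarding \<open>v\<^sub>i\<close> means merging
  the intervals \<open>i - 1\<close> and \<open>i\<close> into a single (possibly unbounded) interval, which is
  possible exactly if their union is convex.
\<close>

definition polygonal_line :: "'n::finite polyline \<Rightarrow> bool" where
  "polygonal_line L \<longleftrightarrow>
     1 \<le> nverts L \<and>
     (\<forall>i\<in>{1..nverts L}. rational_vector (vertex L i)) \<and>
     rational_vector (init_dir L) \<and> rational_vector (final_dir L) \<and>
     (\<forall>i\<le>nverts L. direction L i \<noteq> 0) \<and>
     (\<forall>i j. i < j \<and> j \<le> nverts L \<longrightarrow>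
        interval_of L i \<inter> interval_of L j = (if j = i + 1 then {vertex L j} else {})) \<and>
     (\<forall>i\<in>{1..nverts L}. \<not> convex (interval_of L (i - 1) \<union> interval_of L i))"

text \<open>Vectors of slopes are determined only up to positive factors, one for each interval.\<close>

definition slope_vectors :: "'n::finite polyline \<Rightarrow> (nat \<Rightarrow> real ^ 'n) \<Rightarrow> bool" where
  "slope_vectors L a \<longleftrightarrow> (\<forall>i\<le>nverts L. \<exists>c>0. a i = c *\<^sub>R direction L i)"

definition tropical_rational :: "(real \<Rightarrow> real) \<Rightarrow> bool" where
  "tropical_rational f \<longleftrightarrow>
     continuous_on UNIV f \<and>
     (\<exists>P. finite P \<and> \<Union>P = UNIV \<and>
        (\<forall>I\<in>P. is_interval I \<and> (\<exists>(m::int) b. \<forall>t\<in>I. f t = of_int m * t + b)))"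

definition tropical_polynomial :: "(real \<Rightarrow> real) \<Rightarrow> bool" where
  "tropical_polynomial f \<longleftrightarrow>
     (\<exists>(I::nat set) c. finite I \<and> I \<noteq> {} \<and> (\<forall>t. f t = (MIN i\<in>I. of_nat i * t + c i)))"

definition tropical_laurent_polynomial :: "(real \<Rightarrow> real) \<Rightarrow> bool" where
  "tropical_laurent_polynomial f \<longleftrightarrow>
     (\<exists>(I::int set) c. finite I \<and> I \<noteq> {} \<and> (\<forall>t. f t = (MIN i\<in>I. of_int i * t + c i)))"

definition joint_map :: "('n \<Rightarrow> real \<Rightarrow> real) \<Rightarrow> real \<Rightarrow> real ^ 'n" where
  "joint_map f t = (\<chi> j. f j t)"

text \<open>
  The two conditions on rays say that the map runs through the line in its given direction.
  If there are at least two vertices, this follows from the order of the preimages of the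
  vertices; for a single vertex that order says nothing, and the conditions exclude the
  reversed map. The last condition excludes a change of speed inside an interval, which
  bijectivity and the order conditions alone would permit.
\<close>

definition tropical_rational_parametrisation ::
    "'n::finite polyline \<Rightarrow> ('n \<Rightarrow> real \<Rightarrow> real) \<Rightarrow> bool" where
  "tropical_rational_parametrisation L f \<longleftrightarrow>
     (\<forall>j. tropical_rational (f j)) \<and>
     bij_betw (joint_map f) UNIV (carrier_of L) \<and>
     (\<forall>i\<in>{1..<nverts L}.
        inv (joint_map f) (vertex L i) < inv (joint_map f) (vertex L (i + 1))) \<and>
     (\<forall>x\<in>interval_of L 0. inv (joint_map f) x \<le> inv (joint_map f) (vertex L 1)) \<and>
     (\<forall>x\<in>interval_of L (nverts L).
        inv (joint_map f) (vertex L (nverts L)) \<le> inv (joint_map f) x) \<and>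
     {t. \<exists>j. \<not> f j differentiable at t} =
       (\<lambda>i. inv (joint_map f) (vertex L i)) ` {1..nverts L}"

definition tropical_polynomial_parametrisation ::
    "'n::finite polyline \<Rightarrow> ('n \<Rightarrow> real \<Rightarrow> real) \<Rightarrow> bool" where
  "tropical_polynomial_parametrisation L f \<longleftrightarrow>
     tropical_rational_parametrisation L f \<and> (\<forall>j. tropical_polynomial (f j))"

definition tropical_laurent_parametrisation ::
    "'n::finite polyline \<Rightarrow> ('n \<Rightarrow> real \<Rightarrow> real) \<Rightarrow> bool" where
  "tropical_laurent_parametrisation L f \<longleftrightarrow>
     tropical_rational_parametrisation L f \<and> (\<forall>j. tropical_laurent_polynomial (f j))"

end

theory Submission
  imports Defs
begin

text \<open>
  A parametrisation is determined, up to translation, by the positive speeds \<open>\<mu>\<^sub>i\<close> with which it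
  runs through the intervals: on the \<open>i\<close>-th interval the coordinate \<open>f\<^sub>j\<close> has slope
  \<open>\<mu>\<^sub>i d\<^sub>i\<^sub>,\<^sub>j\<close>, where \<open>d\<^sub>i\<close> is the direction of that interval. Any speeds for which all these
  slopes are integers give a tropical rational parametrisation (\<open>run_parametrisation\<close>), and
  such speeds exist because the directions are rational.

  A tropical Laurent polynomial is the same as a concave tropical rational function, so the
  Laurent case asks for speeds with \<open>\<mu>\<^sub>i\<^sub>+\<^sub>1 d\<^sub>i\<^sub>+\<^sub>1\<^sub>,\<^sub>j \<le> \<mu>\<^sub>i d\<^sub>i\<^sub>,\<^sub>j\<close> for all \<open>i\<close> and \<open>j\<close>. Only the ratios
  \<open>r\<^sub>i = \<mu>\<^sub>i\<^sub>+\<^sub>1 / \<mu>\<^sub>i\<close> matter here, and they can be chosen independently of each other. A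
  coordinate with \<open>d\<^sub>i\<^sub>,\<^sub>j < 0\<close> bounds \<open>r\<^sub>i\<close> from below by \<open>d\<^sub>i\<^sub>,\<^sub>j / d\<^sub>i\<^sub>+\<^sub>1\<^sub>,\<^sub>j\<close>, one with
  \<open>d\<^sub>i\<^sub>+\<^sub>1\<^sub>,\<^sub>j > 0\<close> bounds it from above by the same quotient, and the conditions of the
  proposition say precisely that every such quotient is positive and that no lower bound
  exceeds an upper bound (\<open>concave_bend_if_slopes_descend\<close>, \<open>rational_descent_ratio\<close>). Since
  the bounds are rational, so can be \<open>r\<^sub>i\<close>, and multiplying all speeds by a common denominator
  makes the slopes integers (\<open>descending_integral_speeds\<close>).

  The polynomial case asks in addition that the slopes be nonnegative. If all \<open>d\<^sub>i\<^sub>,\<^sub>j\<close> are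
  nonnegative, then the Laurent condition reduces to the persistence of zeros.

  The conditions are necessary because difference quotients of a concave function descend: it
  suffices to sample \<open>f\<close> at the preimages of the vertices and of one further point on each ray
  (\<open>preimages_of_nodes\<close>), where its increments are the directions of the intervals.
\<close>

section \<open>Minima of finitely many affine functions\<close>

text \<open>
  The line that attains the minimum at \<open>s\<close> stays above the minimum everywhere. This is all
  that the necessity proofs use of concavity, and it keeps track of which slopes can occur.
  The map \<open>e\<close> stands for the embedding of the integers or of the natural numbers.
\<close>

lemma minimum_of_lines_supergradient:
  fixes e :: "'i \<Rightarrow> real"
  assumes "finite I" "I \<noteq> {}" and f: "\<And>t. f t = (MIN i\<in>I. e i * t + c i)"
  shows "\<exists>i\<in>I. \<forall>t. f t \<le> f s + e i * (t - s)"
proof -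
  have "f s \<in> (\<lambda>i. e i * s + c i) ` I"
    unfolding f using assms(1,2) by (intro Min_in) auto
  then obtain i where i: "i \<in> I" "f s = e i * s + c i" by auto
  have "f t \<le> f s + e i * (t - s)" for t
  proof -
    have "f t \<le> e i * t + c i"
      unfolding f using assms(1) i(1) by (intro Min_le) auto
    then show ?thesis using i(2) by (simp add: algebra_simps)
  qed
  with i(1) show ?thesis by blast
qed

text \<open>
  In a tropical polynomial the lines are indexed by their slopes, whereas the pieces of a broken
  line are numbered from left to right and may repeat a slope. Among the lines with a common
  slope, the lowest one serves.
\<close>

lemma minimum_of_lines_collect_slopes:
  fixes e :: "'i \<Rightarrow> real" and \<sigma> :: "nat \<Rightarrow> 'i"
  assumes le: "\<And>t m. m \<le> k \<Longrightarrow> f t \<le> e (\<sigma> m) * t + b m"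
    and attained: "\<And>t. \<exists>m\<le>k. f t = e (\<sigma> m) * t + b m"
  shows "\<exists>I c. finite I \<and> I \<noteq> {} \<and> (\<forall>t. f t = (MIN i\<in>I. e i * t + c i))"
proof -
  define I where "I = \<sigma> ` {..k}"
  define c where "c i = Min (b ` {m. m \<le> k \<and> \<sigma> m = i})" for i
  have fin: "finite (b ` {m. m \<le> k \<and> \<sigma> m = i})" for i by simp
  have "f t = (MIN i\<in>I. e i * t + c i)" for t
  proof (rule Min_eqI[symmetric])
    show "finite ((\<lambda>i. e i * t + c i) ` I)" by (simp add: I_def)
  next
    fix y assume "y \<in> (\<lambda>i. e i * t + c i) ` I"
    then obtain m where m: "m \<le> k" "y = e (\<sigma> m) * t + c (\<sigma> m)" by (auto simp: I_def)
    have "c (\<sigma> m) \<in> b ` {l. l \<le> k \<and> \<sigma> l = \<sigma> m}"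
      unfolding c_def using m(1) by (intro Min_in fin) auto
    then obtain l where "l \<le> k" "\<sigma> l = \<sigma> m" "c (\<sigma> m) = b l" by auto
    with le[of l t] m(2) show "f t \<le> y" by simp
  next
    obtain m where m: "m \<le> k" "f t = e (\<sigma> m) * t + b m" using attained by blast
    have "c (\<sigma> m) \<in> b ` {l. l \<le> k \<and> \<sigma> l = \<sigma> m}"
      unfolding c_def using m(1) by (intro Min_in fin) auto
    then obtain l where l: "l \<le> k" "\<sigma> l = \<sigma> m" "c (\<sigma> m) = b l" by auto
    have "c (\<sigma> m) \<le> b m"
      unfolding c_def using m(1) by (intro Min_le fin) auto
    with le[OF l(1), of t] l m(2) have "f t = e (\<sigma> m) * t + c (\<sigma> m)" by simp
    then show "f t \<in> (\<lambda>i. e i * t + c i) ` I" using m(1) by (auto simp: I_def)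
  qed
  moreover have "finite I" "I \<noteq> {}" by (auto simp: I_def)
  ultimately show ?thesis by blast
qed

section \<open>Broken lines\<close>

text \<open>
  The continuous piecewise linear function with value \<open>q 0\<close> at \<open>\<tau> 0\<close>, with breakpoints
  \<open>\<tau> 1, \<dots>, \<tau> k\<close> and with successive slopes \<open>\<sigma> 0, \<dots>, \<sigma> k\<close>. Written as a sum of hinges, it is
  evidently continuous, and its points of non-differentiability and its concavity can be read
  off from the differences of consecutive slopes. The point \<open>\<tau> 0\<close> is a base point on the leftmost
  piece and no breakpoint.
\<close>

definition broken_line ::
    "(nat \<Rightarrow> real) \<Rightarrow> (nat \<Rightarrow> real) \<Rightarrow> (nat \<Rightarrow> real) \<Rightarrow> nat \<Rightarrow> real \<Rightarrow> real" where
  "broken_line \<tau> q \<sigma> k t =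
     q 0 + \<sigma> 0 * (t - \<tau> 0) + (\<Sum>i<k. (\<sigma> (i + 1) - \<sigma> i) * max 0 (t - \<tau> (i + 1)))"

definition piece :: "(nat \<Rightarrow> real) \<Rightarrow> nat \<Rightarrow> nat \<Rightarrow> real set" where
  "piece \<tau> k m = {t. (0 < m \<longrightarrow> \<tau> m \<le> t) \<and> (m < k \<longrightarrow> t \<le> \<tau> (m + 1))}"

lemma piece_cover: "\<exists>m\<le>k. t \<in> piece \<tau> k m"
proof -
  define S where "S = {m. m \<le> k \<and> (m = 0 \<or> \<tau> m \<le> t)}"
  have fin: "finite S" and "0 \<in> S" by (auto simp: S_def)
  then have M: "Max S \<in> S" by (metis Max_in empty_iff)
  moreover have "Max S < k \<longrightarrow> t \<le> \<tau> (Max S + 1)"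
  proof
    assume "Max S < k"
    moreover have "Max S + 1 \<notin> S" using Max_ge[OF fin, of "Max S + 1"] by auto
    ultimately show "t \<le> \<tau> (Max S + 1)" by (auto simp: S_def)
  qed
  ultimately show ?thesis by (auto simp: S_def piece_def)
qed

lemma UN_piece: "(\<Union>m\<le>k. piece \<tau> k m) = UNIV"
proof (rule UNIV_eq_I[symmetric])
  fix t
  obtain m where "m \<le> k" "t \<in> piece \<tau> k m" using piece_cover by blast
  then show "t \<in> (\<Union>m\<le>k. piece \<tau> k m)" by (intro UN_I) simp_all
qed

lemma is_interval_piece: "is_interval (piece \<tau> k m)"
  by (auto simp: piece_def is_interval_1)

text \<open>
  The values \<open>q i\<close> are redundant, but they give each piece of the broken line the closed form
  \<open>q m + \<sigma> m * (t - \<tau> m)\<close>.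
\<close>

definition interpolates ::
    "nat \<Rightarrow> (nat \<Rightarrow> real) \<Rightarrow> (nat \<Rightarrow> real) \<Rightarrow> (nat \<Rightarrow> real) \<Rightarrow> bool" where
  "interpolates k \<tau> q \<sigma> \<longleftrightarrow> (\<forall>i<k. q (i + 1) = q i + \<sigma> i * (\<tau> (i + 1) - \<tau> i))"

text \<open>
  Each hinge is compared with its contribution to the affine function that extends the
  \<open>m\<close>-th piece: a hinge whose breakpoint lies to the left of that piece contributes its
  linear part, the others contribute nothing.
\<close>

lemma broken_line_minus_affine:
  assumes q: "interpolates k \<tau> q \<sigma>" and "m \<le> k"
  shows "broken_line \<tau> q \<sigma> k t = q m + \<sigma> m * (t - \<tau> m) +
    (\<Sum>i<k. (\<sigma> (i + 1) - \<sigma> i) *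
       (max 0 (t - \<tau> (i + 1)) - (if i < m then t - \<tau> (i + 1) else 0)))"
proof -
  have "q m + \<sigma> m * (t - \<tau> m) =
      q 0 + \<sigma> 0 * (t - \<tau> 0) + (\<Sum>i<m. (\<sigma> (i + 1) - \<sigma> i) * (t - \<tau> (i + 1)))"
    using \<open>m \<le> k\<close>
  proof (induction m)
    case (Suc m)
    with q[unfolded interpolates_def, rule_format, of m] show ?case
      by (simp add: algebra_simps)
  qed simp
  also have "(\<Sum>i<m. (\<sigma> (i + 1) - \<sigma> i) * (t - \<tau> (i + 1))) =
      (\<Sum>i<k. (\<sigma> (i + 1) - \<sigma> i) * (if i < m then t - \<tau> (i + 1) else 0))"
    using \<open>m \<le> k\<close> by (intro sum.mono_neutral_cong_left) auto
  finally show ?thesis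
    by (simp add: broken_line_def right_diff_distrib sum_subtractf)
qed

lemma broken_line_on_piece:
  assumes "interpolates k \<tau> q \<sigma>" and "m \<le> k"
    and \<tau>: "strict_mono \<tau>" and t: "t \<in> piece \<tau> k m"
  shows "broken_line \<tau> q \<sigma> k t = q m + \<sigma> m * (t - \<tau> m)"
proof -
  have "max 0 (t - \<tau> (i + 1)) - (if i < m then t - \<tau> (i + 1) else 0) = 0" if "i < k" for i
  proof (cases "i < m")
    case True
    then have "\<tau> (i + 1) \<le> \<tau> m" using \<tau> by (simp add: strict_mono_less_eq)
    with True t show ?thesis by (auto simp: piece_def)
  next
    case False
    then have "\<tau> (m + 1) \<le> \<tau> (i + 1)" using \<tau> by (simp add: strict_mono_less_eq)
    with False that t show ?thesis by (auto simp: piece_def)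
  qed
  then show ?thesis
    by (subst broken_line_minus_affine[OF assms(1,2)]) auto
qed

text \<open>
  Each bracket in \<open>broken_line_minus_affine\<close> is nonnegative, as \<open>max 0 u\<close> is at least \<open>u\<close> and at least \<open>0\<close>,
  and with descending slopes its coefficient is nonpositive.
\<close>

lemma broken_line_le_affine:
  assumes "interpolates k \<tau> q \<sigma>" and "m \<le> k"
    and "\<And>i. i < k \<Longrightarrow> \<sigma> (i + 1) \<le> \<sigma> i"
  shows "broken_line \<tau> q \<sigma> k t \<le> q m + \<sigma> m * (t - \<tau> m)"
proof -
  have "(\<Sum>i<k. (\<sigma> (i + 1) - \<sigma> i) *
      (max 0 (t - \<tau> (i + 1)) - (if i < m then t - \<tau> (i + 1) else 0))) \<le> 0"
    using assms(3) by (intro sum_nonpos mult_nonpos_nonneg) auto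
  then show ?thesis
    by (subst broken_line_minus_affine[OF assms(1,2)]) auto
qed

lemma tropical_rational_broken_line:
  assumes "interpolates k \<tau> q \<sigma>"
    and "strict_mono \<tau>" and int: "\<And>i. i \<le> k \<Longrightarrow> \<sigma> i \<in> \<int>"
  shows "tropical_rational (broken_line \<tau> q \<sigma> k)"
  unfolding tropical_rational_def
proof (intro conjI exI[of _ "piece \<tau> k ` {..k}"] ballI)
  show "continuous_on UNIV (broken_line \<tau> q \<sigma> k)"
    unfolding broken_line_def by (intro continuous_intros)
  show "finite (piece \<tau> k ` {..k})" by simp
  show "\<Union> (piece \<tau> k ` {..k}) = UNIV" by (rule UN_piece)
  fix I assume "I \<in> piece \<tau> k ` {..k}"
  then obtain m where m: "m \<le> k" "I = piece \<tau> k m" by auto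
  then show "is_interval I" by (simp add: is_interval_piece)
  obtain z where z: "\<sigma> m = of_int z" using int[OF m(1)] by (auto elim: Ints_cases)
  have "broken_line \<tau> q \<sigma> k t = of_int z * t + (q m - \<sigma> m * \<tau> m)" if "t \<in> I" for t
    using broken_line_on_piece[OF assms(1) m(1) assms(2)] that m(2) z
    by (simp add: algebra_simps)
  then show "\<exists>(z::int) b. \<forall>t\<in>I. broken_line \<tau> q \<sigma> k t = of_int z * t + b" by blast
qed

lemma concave_broken_line_minimum_of_lines:
  fixes e :: "'i \<Rightarrow> real" and s :: "nat \<Rightarrow> 'i"
  assumes q: "interpolates k \<tau> q \<sigma>"
    and \<tau>: "strict_mono \<tau>"
    and decreasing: "\<And>i. i < k \<Longrightarrow> \<sigma> (i + 1) \<le> \<sigma> i"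
    and s: "\<And>i. i \<le> k \<Longrightarrow> \<sigma> i = e (s i)"
  shows "\<exists>I c. finite I \<and> I \<noteq> {} \<and> (\<forall>t. broken_line \<tau> q \<sigma> k t = (MIN i\<in>I. e i * t + c i))"
proof (rule minimum_of_lines_collect_slopes)
  show "broken_line \<tau> q \<sigma> k t \<le> e (s m) * t + (q m - \<sigma> m * \<tau> m)" if "m \<le> k" for t m
    using broken_line_le_affine[OF q that decreasing, of t] s[OF that]
    by (simp add: algebra_simps)
  show "\<exists>m\<le>k. broken_line \<tau> q \<sigma> k t = e (s m) * t + (q m - \<sigma> m * \<tau> m)" for t
  proof -
    obtain m where m: "m \<le> k" "t \<in> piece \<tau> k m" using piece_cover by blast
    from broken_line_on_piece[OF q m(1) \<tau> m(2)] s[OF m(1)] m(1)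
    show ?thesis by (auto simp: algebra_simps)
  qed
qed

lemma hinge_differentiable:
  fixes x p c :: real assumes "x \<noteq> p"
  shows "(\<lambda>t. c * max 0 (t - p)) differentiable at x"
proof -
  let ?h = "\<lambda>t::real. c * max 0 (t - p)"
  consider "x < p" | "x > p" using assms by linarith
  then show ?thesis
  proof cases
    case 1
    have "(?h has_real_derivative 0) (at x)"
      by (rule has_field_derivative_transform_within[of "\<lambda>_. 0" _ _ _ "p - x"])
        (use 1 in \<open>auto simp: dist_real_def\<close>)
    then show ?thesis by (auto simp: real_differentiable_def)
  next
    case 2
    have "(?h has_real_derivative c) (at x)"
      by (rule has_field_derivative_transform_within[of "\<lambda>t. c * (t - p)" _ _ _ "x - p"])
        (use 2 in \<open>auto simp: dist_real_def intro!: derivative_eq_intros\<close>)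
    then show ?thesis by (auto simp: real_differentiable_def)
  qed
qed

lemma hinge_not_differentiable:
  fixes c p :: real assumes "c \<noteq> 0"
  shows "\<not> (\<lambda>t. c * max 0 (t - p)) differentiable at p"
proof
  let ?h = "\<lambda>t. c * max 0 (t - p)"
  assume "?h differentiable at p"
  then obtain D where D: "(?h has_real_derivative D) (at p)" by (auto simp: real_differentiable_def)
  have "(?h has_real_derivative 0) (at p within {..p})"
    by (rule has_field_derivative_transform_within[of "\<lambda>_. 0" _ _ _ 1]) auto
  then have "(?h has_real_derivative 0) (at p within {..<p})"
    by (rule has_field_derivative_subset) auto
  moreover have "(?h has_real_derivative D) (at p within {..<p})"
    using D by (rule has_field_derivative_at_within)
  ultimately have "D = 0"
    by (intro has_field_derivative_unique[where f = ?h]) auto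
  have "(?h has_real_derivative c) (at p within {p..})"
    by (rule has_field_derivative_transform_within[of "\<lambda>t. c * (t - p)" _ _ _ 1])
      (auto intro!: derivative_eq_intros)
  then have "(?h has_real_derivative c) (at p within {p<..})"
    by (rule has_field_derivative_subset) auto
  moreover have "(?h has_real_derivative D) (at p within {p<..})"
    using D by (rule has_field_derivative_at_within)
  ultimately have "D = c"
    by (intro has_field_derivative_unique[where f = ?h]) auto
  with \<open>D = 0\<close> assms show False by simp
qed

text \<open>
  As the breakpoints are distinct, at most one hinge bends at \<open>t\<close>. Subtracting all other
  terms isolates it.
\<close>

lemma broken_line_differentiable_iff:
  assumes \<tau>: "strict_mono \<tau>"
  shows "broken_line \<tau> q \<sigma> k differentiable at t \<longleftrightarrow>
    (\<forall>i<k. t = \<tau> (i + 1) \<longrightarrow> \<sigma> (i + 1) = \<sigma> i)"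
proof -
  define h where "h i t = (\<sigma> (i + 1) - \<sigma> i) * max 0 (t - \<tau> (i + 1))" for i t
  have bl: "broken_line \<tau> q \<sigma> k = (\<lambda>t. q 0 + \<sigma> 0 * (t - \<tau> 0) + (\<Sum>i<k. h i t))"
    by (auto simp: broken_line_def h_def)
  have smooth: "h i differentiable at t" if "t = \<tau> (i + 1) \<longrightarrow> \<sigma> (i + 1) = \<sigma> i" for i
  proof (cases "t = \<tau> (i + 1)")
    case True
    with that show ?thesis by (simp add: h_def[abs_def])
  next
    case False
    then show ?thesis unfolding h_def[abs_def] by (rule hinge_differentiable)
  qed
  show ?thesis
  proof (intro iffI)
    assume "\<forall>i<k. t = \<tau> (i + 1) \<longrightarrow> \<sigma> (i + 1) = \<sigma> i"
    then have "h i differentiable at t" if "i < k" for i using that by (intro smooth) blast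
    then show "broken_line \<tau> q \<sigma> k differentiable at t"
      unfolding bl by (intro differentiable_add differentiable_sum) auto
  next
    assume D: "broken_line \<tau> q \<sigma> k differentiable at t"
    show "\<forall>i<k. t = \<tau> (i + 1) \<longrightarrow> \<sigma> (i + 1) = \<sigma> i"
    proof (intro allI impI, rule ccontr)
      fix m assume m: "m < k" "t = \<tau> (m + 1)" "\<sigma> (m + 1) \<noteq> \<sigma> m"
      have "h i differentiable at t" if "i \<in> {..<k} - {m}" for i
      proof -
        have "t \<noteq> \<tau> (i + 1)" using that m(2) \<tau> by (simp add: strict_mono_eq)
        then show ?thesis by (intro smooth) simp
      qed
      then have "(\<lambda>t. broken_line \<tau> q \<sigma> k t - (q 0 + \<sigma> 0 * (t - \<tau> 0)) -
          (\<Sum>i\<in>{..<k} - {m}. h i t)) differentiable at t"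
        by (intro differentiable_diff differentiable_sum D) auto
      moreover have "(\<lambda>t. broken_line \<tau> q \<sigma> k t - (q 0 + \<sigma> 0 * (t - \<tau> 0)) -
          (\<Sum>i\<in>{..<k} - {m}. h i t)) = h m"
        using m(1) by (auto simp: bl sum.remove[of "{..<k}" m])
      ultimately show False
        using hinge_not_differentiable[of "\<sigma> (m + 1) - \<sigma> m" "\<tau> (m + 1)"] m(2,3)
        by (simp add: h_def[abs_def])
    qed
  qed
qed

section \<open>Nodes of a polygonal line\<close>

text \<open>
  The vertices together with one further point on each ray. In this way the direction of
  every interval, bounded or not, is a difference of consecutive nodes.
\<close>

definition node :: "'n::finite polyline \<Rightarrow> nat \<Rightarrow> real ^ 'n" where
  "node L i =
     (if i = 0 then vertex L 1 - init_dir L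
      else if i \<le> nverts L then vertex L i
      else vertex L (nverts L) + final_dir L)"

lemma node_Suc: "node L (i + 1) = node L i + direction L i" if "1 \<le> nverts L" "i \<le> nverts L"
  using that by (auto simp: node_def direction_def not_le less_Suc_eq_le)

text \<open>
  An interval seen from its left vertex, and below, from its right vertex: the first form covers
  the final ray, the second one the initial ray, and both cover the segments.
\<close>

lemma interval_of_forward:
  assumes "1 \<le> i" "i \<le> nverts L"
  shows "interval_of L i =
    (\<lambda>s. vertex L i + s *\<^sub>R direction L i) ` {s. 0 \<le> s \<and> (i < nverts L \<longrightarrow> s \<le> 1)}"
proof (cases "i = nverts L")
  case True
  then show ?thesis using assms by (auto simp: interval_of_def direction_def)
next
  case False
  then show ?thesis using assms
    by (auto simp: interval_of_def direction_def closed_segment_image_interval algebra_simps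
          image_def)
qed

lemma interval_of_backward:
  assumes "i < nverts L"
  shows "interval_of L i =
    (\<lambda>s. vertex L (i + 1) - s *\<^sub>R direction L i) ` {s. 0 \<le> s \<and> (0 < i \<longrightarrow> s \<le> 1)}"
proof (cases "i = 0")
  case True
  then show ?thesis using assms by (auto simp: interval_of_def direction_def)
next
  case False
  have "interval_of L i = closed_segment (vertex L (i + 1)) (vertex L i)"
    using False assms by (simp add: interval_of_def closed_segment_commute)
  with False assms show ?thesis
    by (auto simp: direction_def closed_segment_image_interval algebra_simps image_def)
qed

text \<open>
  If two consecutive directions differ by a positive factor only, then both intervals lie on one
  line through their common vertex, on opposite sides of it. As no vertex can be discarded,
  this forces a parametrisation to bend at every vertex.
\<close>

lemma union_convex_if_parallel:
  assumes i: "1 \<le> i" "i \<le> nverts L" and "c > 0"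
    and par: "direction L i = c *\<^sub>R direction L (i - 1)"
  shows "convex (interval_of L (i - 1) \<union> interval_of L i)"
proof -
  let ?g = "\<lambda>s. vertex L i + s *\<^sub>R direction L (i - 1)"
  let ?J = "{s. (0 < i - 1 \<longrightarrow> - 1 \<le> s) \<and> (i < nverts L \<longrightarrow> s \<le> c)}"
  have "interval_of L (i - 1) = ?g ` {s. s \<le> 0 \<and> (0 < i - 1 \<longrightarrow> - 1 \<le> s)}"
  proof -
    have "interval_of L (i - 1) = ?g ` uminus ` {s. 0 \<le> s \<and> (0 < i - 1 \<longrightarrow> s \<le> 1)}"
      using interval_of_backward[of "i - 1" L] i by (simp add: image_image)
    also have "uminus ` {s::real. 0 \<le> s \<and> (0 < i - 1 \<longrightarrow> s \<le> 1)} =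
        {s. s \<le> 0 \<and> (0 < i - 1 \<longrightarrow> - 1 \<le> s)}"
    proof (intro equalityI subsetI)
      fix s :: real assume "s \<in> {s. s \<le> 0 \<and> (0 < i - 1 \<longrightarrow> - 1 \<le> s)}"
      then have "s = - (- s)" "- s \<in> {s. 0 \<le> s \<and> (0 < i - 1 \<longrightarrow> s \<le> 1)}" by auto
      then show "s \<in> uminus ` {s. 0 \<le> s \<and> (0 < i - 1 \<longrightarrow> s \<le> 1)}" by (rule image_eqI)
    qed auto
    finally show ?thesis .
  qed
  moreover have "interval_of L i = ?g ` {s. 0 \<le> s \<and> (i < nverts L \<longrightarrow> s \<le> c)}"
  proof -
    have "interval_of L i = ?g ` (\<lambda>s. s * c) ` {s. 0 \<le> s \<and> (i < nverts L \<longrightarrow> s \<le> 1)}"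
      unfolding interval_of_forward[OF i] par by (simp add: image_image)
    also have "(\<lambda>s. s * c) ` {s. 0 \<le> s \<and> (i < nverts L \<longrightarrow> s \<le> 1)} =
        {s. 0 \<le> s \<and> (i < nverts L \<longrightarrow> s \<le> c)}"
    proof (intro equalityI subsetI)
      fix s assume "s \<in> {s. 0 \<le> s \<and> (i < nverts L \<longrightarrow> s \<le> c)}"
      then have "s = (s / c) * c" "s / c \<in> {s. 0 \<le> s \<and> (i < nverts L \<longrightarrow> s \<le> 1)}"
        using \<open>c > 0\<close> by auto
      then show "s \<in> (\<lambda>s. s * c) ` {s. 0 \<le> s \<and> (i < nverts L \<longrightarrow> s \<le> 1)}" by (rule image_eqI)
    qed (use \<open>c > 0\<close> in auto)
    finally show ?thesis .
  qed
  ultimately have "interval_of L (i - 1) \<union> interval_of L i = ?g ` ?J"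
    using \<open>c > 0\<close> by (auto simp flip: image_Un intro!: arg_cong[of _ _ "image ?g"])
  also have "?g ` ?J = (+) (vertex L i) ` (\<lambda>s. s *\<^sub>R direction L (i - 1)) ` ?J"
    by (simp add: image_image)
  also have "convex \<dots>"
  proof (intro convex_translation convex_linear_image)
    show "linear (\<lambda>s. s *\<^sub>R direction L (i - 1))" by (simp add: linear_iff algebra_simps)
    show "convex ?J" by (auto simp flip: is_interval_convex_1 simp: is_interval_1)
  qed
  finally show ?thesis .
qed

section \<open>Slopes of a parametrisation\<close>

text \<open>
  The order conditions on a parametrisation make the preimages of the nodes increase; this
  includes the two nodes on the rays, where the conditions on the rays are used. Strictness holds
  because the directions are nonzero.
\<close>

lemma preimages_of_nodes:
  assumes L: "polygonal_line L" and f: "tropical_rational_parametrisation L f"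
  obtains \<tau> where "\<And>i. i \<le> nverts L \<Longrightarrow> \<tau> i < \<tau> (i + 1)"
    and "\<And>i j. i \<le> nverts L \<Longrightarrow> direction L i $ j = f j (\<tau> (i + 1)) - f j (\<tau> i)"
proof
  let ?F = "joint_map f" and ?k = "nverts L"
  define \<tau> where "\<tau> i = inv ?F (node L i)" for i
  have k: "1 \<le> ?k" and nz: "\<And>i. i \<le> ?k \<Longrightarrow> direction L i \<noteq> 0"
    using L by (auto simp: polygonal_line_def)
  have bij: "bij_betw ?F UNIV (carrier_of L)"
    using f by (simp add: tropical_rational_parametrisation_def)
  have first: "node L 0 \<in> interval_of L 0"
    by (auto simp: interval_of_def node_def intro!: exI[of _ 1])
  have last: "node L (?k + 1) \<in> interval_of L ?k"
    using k by (auto simp: interval_of_def node_def intro!: exI[of _ 1])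
  have inner: "node L i \<in> interval_of L i" if "1 \<le> i" "i \<le> ?k" for i
    using that by (auto simp: interval_of_def node_def intro!: exI[of _ 0])
  have "node L i \<in> carrier_of L" if i: "i \<le> ?k + 1" for i
  proof -
    consider "i = 0" | "i = ?k + 1" | "1 \<le> i" "i \<le> ?k" using i by linarith
    then show ?thesis unfolding carrier_of_def using first last inner by cases auto
  qed
  then have F\<tau>: "?F (\<tau> i) = node L i" if "i \<le> ?k + 1" for i
    using that bij unfolding \<tau>_def by (metis bij_betw_imp_surj_on f_inv_into_f)
  show dir: "direction L i $ j = f j (\<tau> (i + 1)) - f j (\<tau> i)" if "i \<le> ?k" for i j
  proof -
    have "direction L i = ?F (\<tau> (i + 1)) - ?F (\<tau> i)"
      using node_Suc[OF k that] F\<tau> that by simp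
    then show ?thesis by (simp add: joint_map_def)
  qed
  show "\<tau> i < \<tau> (i + 1)" if i: "i \<le> ?k" for i
  proof -
    have "\<tau> i \<noteq> \<tau> (i + 1)" using dir[OF i] nz[OF i] by (auto simp: vec_eq_iff)
    moreover have "\<tau> i \<le> \<tau> (i + 1)"
    proof -
      consider "i = 0" | "i = ?k" | "1 \<le> i" "i < ?k" using i by linarith
      then show ?thesis
      proof cases
        case 1
        then show ?thesis using f first k
          by (auto simp: tropical_rational_parametrisation_def \<tau>_def node_def)
      next
        case 2
        then show ?thesis using f last k
          by (auto simp: tropical_rational_parametrisation_def \<tau>_def node_def)
      next
        case 3
        then show ?thesis using f
          by (auto simp: tropical_rational_parametrisation_def \<tau>_def node_def less_imp_le)
      qed
    qed
    ultimately show ?thesis by simp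
  qed
qed

text \<open>
  The relation between consecutive slope vectors in the Laurent case. It says that the speeds on
  the two intervals can be chosen so that no coordinate bends upwards.
\<close>

definition concave_bend :: "real ^ 'n \<Rightarrow> real ^ 'n \<Rightarrow> bool" where
  "concave_bend u w \<longleftrightarrow>
     (\<forall>j. u $ j < 0 \<longrightarrow> w $ j < 0) \<and>
     (\<forall>j. w $ j > 0 \<longrightarrow> u $ j > 0) \<and>
     (\<forall>j j0. j \<noteq> j0 \<longrightarrow>
        u $ j0 > 0 \<and> w $ j0 > 0 \<and> u $ j < 0 \<and> w $ j < 0 \<longrightarrow> u $ j0 / u $ j \<le> w $ j0 / w $ j)"

lemma concave_bend_scale:
  assumes "c > 0" "d > 0"
  shows "concave_bend (c *\<^sub>R u) (d *\<^sub>R w) \<longleftrightarrow> concave_bend u w"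
  using assms by (simp add: concave_bend_def zero_less_mult_iff mult_less_0_iff)

lemma concave_bend_if_slopes_descend:
  assumes "r > 0" and r: "\<And>j. r * w $ j \<le> u $ j"
  shows "concave_bend u w"
  unfolding concave_bend_def
proof (intro conjI allI impI)
  show "w $ j < 0" if "u $ j < 0" for j
    using r[of j] that \<open>r > 0\<close> by (smt (verit) mult_nonneg_nonneg)
  show "u $ j > 0" if "w $ j > 0" for j
    using r[of j] that \<open>r > 0\<close> by (smt (verit) mult_pos_pos)
  show "u $ i / u $ j \<le> w $ i / w $ j" if *: "u $ i > 0 \<and> w $ i > 0 \<and> u $ j < 0 \<and> w $ j < 0" for i j
  proof -
    have "u $ j / w $ j \<le> r" using r[of j] * by (simp add: field_simps)
    also have "r \<le> u $ i / w $ i" using r[of i] * by (simp add: field_simps)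
    finally show ?thesis using * by (simp add: field_simps)
  qed
qed

lemma rational_between:
  fixes A B :: "real set"
  assumes "finite A" "finite B" and pos: "\<And>x. x \<in> A \<union> B \<Longrightarrow> x \<in> \<rat> \<and> x > 0"
    and le: "\<And>x y. x \<in> A \<Longrightarrow> y \<in> B \<Longrightarrow> x \<le> y"
  shows "\<exists>r\<in>\<rat>. r > 0 \<and> (\<forall>x\<in>A. x \<le> r) \<and> (\<forall>y\<in>B. r \<le> y)"
proof -
  consider "A \<noteq> {}" | "A = {}" "B \<noteq> {}" | "A = {}" "B = {}" by blast
  then show ?thesis
  proof cases
    case 1
    then have "Max A \<in> A" using assms(1) by simp
    then show ?thesis using assms by (intro bexI[of _ "Max A"]) auto
  next
    case 2
    then have "Min B \<in> B" using assms(2) by simp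
    then show ?thesis using 2 assms by (intro bexI[of _ "Min B"]) auto
  next
    case 3
    then show ?thesis by (intro bexI[of _ 1]) auto
  qed
qed

text \<open>
  The inequality for a coordinate \<open>j\<close> is a lower bound on \<open>r\<close> if \<open>u $ j < 0\<close>, an upper bound if
  \<open>w $ j > 0\<close>, and holds for every positive \<open>r\<close> otherwise. The relation makes all bounds
  positive and every lower bound at most every upper bound, and the bounds are rational.
\<close>

lemma rational_descent_ratio:
  fixes u w :: "real ^ 'n::finite"
  assumes "rational_vector u" "rational_vector w"
    and bend: "concave_bend u w"
  shows "\<exists>r\<in>\<rat>. r > 0 \<and> (\<forall>j. r * w $ j \<le> u $ j)"
proof -
  have neg: "\<And>j. u $ j < 0 \<Longrightarrow> w $ j < 0" and pos: "\<And>j. w $ j > 0 \<Longrightarrow> u $ j > 0"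
    using bend by (auto simp: concave_bend_def)
  have ratio: "u $ i / u $ j \<le> w $ i / w $ j"
    if "u $ i > 0" "w $ i > 0" "u $ j < 0" "w $ j < 0" for i j
  proof -
    have "j \<noteq> i" using that by auto
    with that bend show ?thesis by (auto simp: concave_bend_def)
  qed
  let ?A = "(\<lambda>j. u $ j / w $ j) ` {j. u $ j < 0}"
  let ?B = "(\<lambda>j. u $ j / w $ j) ` {j. w $ j > 0}"
  have "\<exists>r\<in>\<rat>. r > 0 \<and> (\<forall>x\<in>?A. x \<le> r) \<and> (\<forall>y\<in>?B. r \<le> y)"
  proof (rule rational_between)
    show "x \<in> \<rat> \<and> x > 0" if "x \<in> ?A \<union> ?B" for x
      using that assms(1,2) neg pos
      by (auto simp: rational_vector_def divide_neg_neg)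
    fix x y assume "x \<in> ?A" "y \<in> ?B"
    then obtain i j where j: "u $ j < 0" "x = u $ j / w $ j" and i: "w $ i > 0" "y = u $ i / w $ i"
      by auto
    have "u $ i * w $ j \<le> u $ j * w $ i"
      using ratio[OF pos[OF i(1)] i(1) j(1) neg[OF j(1)]] j(1) neg[OF j(1)] by (simp add: field_simps)
    then show "x \<le> y" unfolding i(2) j(2) using i(1) neg[OF j(1)]
      by (simp add: divide_simps mult.commute)
  qed auto
  then obtain r where r: "r \<in> \<rat>" "r > 0" "\<And>j. u $ j < 0 \<Longrightarrow> u $ j / w $ j \<le> r"
      "\<And>j. w $ j > 0 \<Longrightarrow> r \<le> u $ j / w $ j" by auto
  have "r * w $ j \<le> u $ j" for j
  proof -
    consider "u $ j < 0" | "w $ j > 0" | "u $ j \<ge> 0" "w $ j \<le> 0" by linarith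
    then show ?thesis
    proof cases
      case 1
      then show ?thesis using r(3)[of j] neg[of j] by (simp add: field_simps)
    next
      case 2
      then show ?thesis using r(4)[of j] by (simp add: field_simps)
    next
      case 3
      then show ?thesis using r(2) by (smt (verit) mult_nonneg_nonpos)
    qed
  qed
  with r(1,2) show ?thesis by blast
qed

text \<open>
  A supergradient of \<open>f j\<close> at the preimage of the node between two intervals separates the
  difference quotients on its two sides. The ratio of the times spent on the two intervals
  is then a common witness for all coordinates.
\<close>

lemma laurent_concave_bend:
  assumes L: "polygonal_line L" and f: "tropical_laurent_parametrisation L f"
    and i: "i < nverts L"
  shows "concave_bend (direction L i) (direction L (i + 1))"
proof -
  have rat: "tropical_rational_parametrisation L f"
    using f by (simp add: tropical_laurent_parametrisation_def)
  obtain \<tau> where \<tau>: "\<And>i. i \<le> nverts L \<Longrightarrow> \<tau> i < \<tau> (i + 1)"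
    and dir: "\<And>i j. i \<le> nverts L \<Longrightarrow> direction L i $ j = f j (\<tau> (i + 1)) - f j (\<tau> i)"
    using preimages_of_nodes[OF L rat] by blast
  define d e where "d = \<tau> (i + 1) - \<tau> i" and "e = \<tau> (i + 2) - \<tau> (i + 1)"
  have "d > 0" "e > 0" using \<tau>[of i] \<tau>[of "i + 1"] i by (auto simp: d_def e_def)
  have "d / e * direction L (i + 1) $ j \<le> direction L i $ j" for j
  proof -
    have "tropical_laurent_polynomial (f j)"
      using f by (simp add: tropical_laurent_parametrisation_def)
    then obtain I c where "finite I" "I \<noteq> {}" "\<And>t. f j t = (MIN i\<in>I. of_int i * t + c i)"
      unfolding tropical_laurent_polynomial_def by blast
    then obtain m :: int where m: "\<And>t. f j t \<le> f j (\<tau> (i + 1)) + of_int m * (t - \<tau> (i + 1))"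
      using minimum_of_lines_supergradient[of I "f j" of_int c "\<tau> (i + 1)"] by blast
    have "direction L (i + 1) $ j \<le> of_int m * e"
      using m[of "\<tau> (i + 2)"] dir[of "i + 1" j] i by (simp add: e_def)
    then have "d / e * direction L (i + 1) $ j \<le> d / e * (of_int m * e)"
      using \<open>d > 0\<close> \<open>e > 0\<close> by (intro mult_left_mono) auto
    also have "\<dots> = of_int m * d" using \<open>e > 0\<close> by simp
    also have "\<dots> \<le> direction L i $ j"
      using m[of "\<tau> i"] dir[of i j] i by (simp add: d_def algebra_simps)
    finally show ?thesis .
  qed
  moreover have "d / e > 0" using \<open>d > 0\<close> \<open>e > 0\<close> by simp
  ultimately show ?thesis by (rule concave_bend_if_slopes_descend[rotated])
qed

lemma tropical_polynomial_imp_laurent: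
  assumes "tropical_polynomial f"
  shows "tropical_laurent_polynomial f"
proof -
  obtain I :: "nat set" and c where I: "finite I" "I \<noteq> {}" "\<And>t. f t = (MIN i\<in>I. of_nat i * t + c i)"
    using assms unfolding tropical_polynomial_def by blast
  have "f t = (MIN i\<in>int ` I. of_int i * t + c (nat i))" for t
    using I(3) by (simp add: image_image)
  with I(1,2) show ?thesis
    unfolding tropical_laurent_polynomial_def
    by (intro exI[of _ "int ` I"] exI[of _ "\<lambda>i. c (nat i)"]) auto
qed

lemma tropical_polynomial_mono:
  assumes "tropical_polynomial f"
  shows "mono f"
proof
  fix x y :: real assume "x \<le> y"
  obtain I :: "nat set" and c where "finite I" "I \<noteq> {}" "\<And>t. f t = (MIN i\<in>I. of_nat i * t + c i)"
    using assms unfolding tropical_polynomial_def by blast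
  then obtain m :: nat where "f x \<le> f y + of_nat m * (x - y)"
    using minimum_of_lines_supergradient[of I f of_nat c y] by blast
  also have "\<dots> \<le> f y" using \<open>x \<le> y\<close> by (simp add: mult_nonneg_nonpos)
  finally show "f x \<le> f y" .
qed

lemma polynomial_direction_nonneg:
  assumes L: "polygonal_line L" and f: "tropical_polynomial_parametrisation L f"
    and i: "i \<le> nverts L"
  shows "direction L i $ j \<ge> 0"
proof -
  have rat: "tropical_rational_parametrisation L f" and "mono (f j)"
    using f by (auto simp: tropical_polynomial_parametrisation_def tropical_polynomial_mono)
  obtain \<tau> where "\<And>i. i \<le> nverts L \<Longrightarrow> \<tau> i < \<tau> (i + 1)"
    and "\<And>i j. i \<le> nverts L \<Longrightarrow> direction L i $ j = f j (\<tau> (i + 1)) - f j (\<tau> i)"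
    using preimages_of_nodes[OF L rat] by blast
  then show ?thesis using i \<open>mono (f j)\<close> by (simp add: monoD less_imp_le)
qed

section \<open>Parametrisations with prescribed speeds\<close>

text \<open>
  At speed \<open>\<mu> i\<close>, the way from node \<open>i\<close> to node \<open>i + 1\<close> takes the time \<open>1 / \<mu> i\<close>, so
  this is the time at which node \<open>i\<close> is reached from node \<open>0\<close>.
\<close>

definition knot :: "(nat \<Rightarrow> real) \<Rightarrow> nat \<Rightarrow> real" where
  "knot \<mu> i = (\<Sum>l<i. 1 / \<mu> l)"

definition run :: "'n::finite polyline \<Rightarrow> (nat \<Rightarrow> real) \<Rightarrow> 'n \<Rightarrow> real \<Rightarrow> real" where
  "run L \<mu> j =
     broken_line (knot \<mu>) (\<lambda>i. node L i $ j) (\<lambda>i. \<mu> i * direction L i $ j) (nverts L)"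

context
  fixes L :: "'n::finite polyline" and \<mu> :: "nat \<Rightarrow> real"
  assumes L: "polygonal_line L" and \<mu>: "\<And>i. \<mu> i > 0"
begin

lemma strict_mono_knot: "strict_mono (knot \<mu>)"
  unfolding strict_mono_Suc_iff using \<mu> by (simp add: knot_def)

lemma run_interpolates:
  "interpolates (nverts L) (knot \<mu>) (\<lambda>i. node L i $ j) (\<lambda>i. \<mu> i * direction L i $ j)"
  unfolding interpolates_def
proof (intro allI impI)
  fix i assume "i < nverts L"
  then have "node L (i + 1) = node L i + direction L i" by (intro node_Suc) auto
  then show "node L (i + 1) $ j =
      node L i $ j + \<mu> i * direction L i $ j * (knot \<mu> (i + 1) - knot \<mu> i)"
    using \<mu>[of i] by (simp add: knot_def)
qed

lemma run_on_piece:
  assumes "m \<le> nverts L" "t \<in> piece (knot \<mu>) (nverts L) m"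
  shows "joint_map (run L \<mu>) t = node L m + ((t - knot \<mu> m) * \<mu> m) *\<^sub>R direction L m"
  using broken_line_on_piece[OF run_interpolates assms(1) strict_mono_knot assms(2)]
  by (auto simp: vec_eq_iff joint_map_def run_def mult_ac)

text \<open>
  The initial ray is treated apart: its base point, node \<open>0\<close>, lies inside the ray, whereas on every
  other interval the base point is the left vertex.
\<close>

lemma run_image_piece:
  assumes m: "m \<le> nverts L"
  shows "joint_map (run L \<mu>) ` piece (knot \<mu>) (nverts L) m = interval_of L m"
proof (cases "m = 0")
  case True
  have k: "1 \<le> nverts L" using L by (simp add: polygonal_line_def)
  have "joint_map (run L \<mu>) ` piece (knot \<mu>) (nverts L) m =
      (\<lambda>t. node L 0 + (t * \<mu> 0) *\<^sub>R init_dir L) ` {..1 / \<mu> 0}"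
    using run_on_piece[OF m] True k by (intro image_cong) (auto simp: piece_def knot_def direction_def)
  also have "\<dots> = interval_of L 0"
  proof (intro equalityI subsetI)
    fix x assume "x \<in> interval_of L 0"
    then obtain s where s: "0 \<le> s" "x = vertex L 1 - s *\<^sub>R init_dir L"
      by (auto simp: interval_of_def)
    have "x = node L 0 + ((1 - s) / \<mu> 0 * \<mu> 0) *\<^sub>R init_dir L"
      unfolding s(2) using \<mu>[of 0] by (simp add: node_def scaleR_diff_left)
    moreover have "(1 - s) / \<mu> 0 \<le> 1 / \<mu> 0" using s(1) \<mu>[of 0] by (simp add: divide_right_mono)
    ultimately show "x \<in> (\<lambda>t. node L 0 + (t * \<mu> 0) *\<^sub>R init_dir L) ` {..1 / \<mu> 0}" by (intro image_eqI) auto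
  next
    fix x assume "x \<in> (\<lambda>t. node L 0 + (t * \<mu> 0) *\<^sub>R init_dir L) ` {..1 / \<mu> 0}"
    then obtain t where t: "t \<le> 1 / \<mu> 0" "x = node L 0 + (t * \<mu> 0) *\<^sub>R init_dir L" by auto
    have "x = vertex L 1 - (1 - t * \<mu> 0) *\<^sub>R init_dir L"
      using t(2) by (simp add: node_def algebra_simps)
    moreover have "0 \<le> 1 - t * \<mu> 0" using t(1) \<mu>[of 0] by (simp add: field_simps)
    ultimately show "x \<in> interval_of L 0" by (auto simp: interval_of_def)
  qed
  finally show ?thesis using True by simp
next
  case False
  let ?P = "piece (knot \<mu>) (nverts L) m" and ?S = "{s::real. 0 \<le> s \<and> (m < nverts L \<longrightarrow> s \<le> 1)}"
  have "(\<lambda>t. (t - knot \<mu> m) * \<mu> m) ` ?P = ?S"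
  proof (intro equalityI subsetI)
    fix s assume s: "s \<in> ?S"
    have "s / \<mu> m + knot \<mu> m \<in> ?P"
      using s False \<mu>[of m] by (auto simp: piece_def knot_def divide_right_mono)
    moreover have "s = (s / \<mu> m + knot \<mu> m - knot \<mu> m) * \<mu> m" using \<mu>[of m] by simp
    ultimately show "s \<in> (\<lambda>t. (t - knot \<mu> m) * \<mu> m) ` ?P" by (intro image_eqI)
  next
    fix s assume "s \<in> (\<lambda>t. (t - knot \<mu> m) * \<mu> m) ` ?P"
    then show "s \<in> ?S" using False \<mu>[of m] by (auto simp: piece_def knot_def field_simps)
  qed
  moreover have "(\<lambda>s. node L m + s *\<^sub>R direction L m) ` (\<lambda>t. (t - knot \<mu> m) * \<mu> m) ` ?P =
      (\<lambda>t. node L m + ((t - knot \<mu> m) * \<mu> m) *\<^sub>R direction L m) ` ?P"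
    by (simp add: image_image)
  ultimately have "(\<lambda>s. node L m + s *\<^sub>R direction L m) ` ?S =
      (\<lambda>t. node L m + ((t - knot \<mu> m) * \<mu> m) *\<^sub>R direction L m) ` ?P"
    by simp
  also have "\<dots> = joint_map (run L \<mu>) ` ?P"
    using run_on_piece[OF m] by (intro image_cong) auto
  finally show ?thesis using interval_of_forward[of m L] False m by (simp add: node_def)
qed

lemma run_knot:
  assumes "1 \<le> i" "i \<le> nverts L"
  shows "joint_map (run L \<mu>) (knot \<mu> i) = vertex L i"
proof -
  have "knot \<mu> i \<in> piece (knot \<mu>) (nverts L) i"
    using strict_mono_knot by (auto simp: piece_def strict_mono_less_eq)
  from run_on_piece[OF assms(2) this] assms show ?thesis by (simp add: node_def)
qed

lemma inj_on_piece:
  assumes "m \<le> nverts L"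
  shows "inj_on (joint_map (run L \<mu>)) (piece (knot \<mu>) (nverts L) m)"
proof (rule inj_onI)
  fix x y assume xy: "x \<in> piece (knot \<mu>) (nverts L) m" "y \<in> piece (knot \<mu>) (nverts L) m"
    and "joint_map (run L \<mu>) x = joint_map (run L \<mu>) y"
  then have "((x - knot \<mu> m) * \<mu> m) *\<^sub>R direction L m = ((y - knot \<mu> m) * \<mu> m) *\<^sub>R direction L m"
    using run_on_piece[OF assms] by simp
  moreover have "direction L m \<noteq> 0" using L assms by (simp add: polygonal_line_def)
  ultimately show "x = y" using \<mu>[of m] by simp
qed

text \<open>
  Within one interval the speed is constant and nonzero. Two points of different intervals can
  only have the same image if the intervals are consecutive and the image is their common
  vertex, which is the image of their common knot within either piece.
\<close>

lemma inj_run: "inj (joint_map (run L \<mu>))"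
proof -
  let ?F = "joint_map (run L \<mu>)" and ?P = "piece (knot \<mu>) (nverts L)"
  have *: "x = y" if xy: "?F x = ?F y" and m: "m < l" "l \<le> nverts L" "x \<in> ?P m" "y \<in> ?P l" for x y m l
  proof -
    have "?F x \<in> interval_of L m \<inter> interval_of L l"
      using run_image_piece[of m] run_image_piece[of l] m xy by (metis IntI image_eqI less_imp_le less_le_trans)
    moreover have "interval_of L m \<inter> interval_of L l = (if l = m + 1 then {vertex L l} else {})"
      using L m(1,2) by (simp add: polygonal_line_def)
    ultimately have l: "l = m + 1" and v: "?F x = vertex L l" by (auto split: if_splits)
    have k: "?F (knot \<mu> l) = ?F x" using run_knot[of l] l m(2) v by simp
    have "knot \<mu> l \<in> ?P m" "knot \<mu> l \<in> ?P l"
      using strict_mono_knot l by (auto simp: piece_def strict_mono_less_eq)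
    moreover have "inj_on ?F (?P m)" "inj_on ?F (?P l)" using m by (auto intro: inj_on_piece)
    moreover have "?F (knot \<mu> l) = ?F y" using k xy by simp
    ultimately have "knot \<mu> l = x" "knot \<mu> l = y" using k m(3,4) by (meson inj_onD)+
    then show ?thesis by simp
  qed
  show ?thesis
  proof (rule injI)
    fix x y assume xy: "?F x = ?F y"
    obtain m l where m: "m \<le> nverts L" "x \<in> ?P m" and l: "l \<le> nverts L" "y \<in> ?P l"
      using piece_cover by metis
    consider "m < l" | "l < m" | "m = l" by linarith
    then show "x = y"
    proof cases
      case 1
      with * xy m l show ?thesis by blast
    next
      case 2
      with *[of y x l m] xy m l show ?thesis by auto
    next
      case 3
      with inj_on_piece[OF m(1)] xy m(2) l(2) show ?thesis by (meson inj_onD)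
    qed
  qed
qed

lemma range_run: "range (joint_map (run L \<mu>)) = carrier_of L"
proof -
  have "range (joint_map (run L \<mu>)) =
      (\<Union>m\<le>nverts L. joint_map (run L \<mu>) ` piece (knot \<mu>) (nverts L) m)"
    by (simp add: UN_piece flip: image_UN)
  then show ?thesis by (simp add: run_image_piece carrier_of_def)
qed

lemma run_differentiable_iff:
  "{t. \<exists>j. \<not> run L \<mu> j differentiable at t} = knot \<mu> ` {1..nverts L}"
proof -
  have bend: "\<exists>j. \<mu> (i + 1) * direction L (i + 1) $ j \<noteq> \<mu> i * direction L i $ j" if "i < nverts L" for i
  proof (rule ccontr)
    assume "\<not> ?thesis"
    then have "direction L (i + 1) = (\<mu> i / \<mu> (i + 1)) *\<^sub>R direction L i"
      using \<mu>[of "i + 1"] by (simp add: vec_eq_iff field_simps)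
    then have "convex (interval_of L i \<union> interval_of L (i + 1))"
      using union_convex_if_parallel[of "i + 1" L "\<mu> i / \<mu> (i + 1)"] that \<mu> by simp
    then show False using L that by (auto simp: polygonal_line_def dest!: bspec[of _ _ "i + 1"])
  qed
  have "{t. \<exists>j. \<not> run L \<mu> j differentiable at t} = {knot \<mu> (i + 1) |i. i < nverts L}"
    unfolding run_def broken_line_differentiable_iff[OF strict_mono_knot] using bend by blast
  also have "\<dots> = knot \<mu> ` {1..nverts L}"
  proof -
    have "{1..nverts L} = Suc ` {..<nverts L}" by (simp add: image_Suc_lessThan)
    then show ?thesis by auto
  qed
  finally show ?thesis .
qed

lemma run_parametrisation:
  assumes int: "\<And>i j. i \<le> nverts L \<Longrightarrow> \<mu> i * direction L i $ j \<in> \<int>"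
  shows "tropical_rational_parametrisation L (run L \<mu>)"
proof -
  let ?F = "joint_map (run L \<mu>)" and ?k = "nverts L"
  have k: "1 \<le> ?k" using L by (simp add: polygonal_line_def)
  have inv_knot: "inv ?F (vertex L i) = knot \<mu> i" if "i \<in> {1..?k}" for i
    using that run_knot[of i] inj_run by (metis atLeastAtMost_iff inv_f_f)
  have inv_piece: "inv ?F x \<in> piece (knot \<mu>) ?k m" if x: "x \<in> interval_of L m" "m \<le> ?k" for x m
  proof -
    obtain t where "t \<in> piece (knot \<mu>) ?k m" "x = ?F t"
      using x(1) run_image_piece[OF x(2)] by blast
    then show ?thesis using inj_run by (simp add: inv_f_f)
  qed
  show ?thesis
    unfolding tropical_rational_parametrisation_def
  proof (intro conjI allI ballI)
    show "tropical_rational (run L \<mu> j)" for j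
      unfolding run_def by (intro tropical_rational_broken_line run_interpolates strict_mono_knot int)
    show "bij_betw ?F UNIV (carrier_of L)"
      using inj_run range_run by (simp add: bij_betw_def)
    show "inv ?F (vertex L i) < inv ?F (vertex L (i + 1))" if "i \<in> {1..<?k}" for i
      using that inv_knot strict_mono_knot by (simp add: strict_mono_less)
    show "inv ?F x \<le> inv ?F (vertex L 1)" if "x \<in> interval_of L 0" for x
      using inv_piece[OF that] inv_knot[of 1] k by (simp add: piece_def)
    show "inv ?F (vertex L ?k) \<le> inv ?F x" if "x \<in> interval_of L ?k" for x
      using inv_piece[OF that] inv_knot[of ?k] k by (simp add: piece_def)
    show "{t. \<exists>j. \<not> run L \<mu> j differentiable at t} = (\<lambda>i. inv ?F (vertex L i)) ` {1..?k}"
      unfolding run_differentiable_iff using inv_knot by (intro image_cong) auto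
  qed
qed

lemma run_minimum_of_lines:
  fixes e :: "'i \<Rightarrow> real"
  assumes range: "\<And>i. i \<le> nverts L \<Longrightarrow> \<mu> i * direction L i $ j \<in> range e"
    and dec: "\<And>i. i < nverts L \<Longrightarrow> \<mu> (i + 1) * direction L (i + 1) $ j \<le> \<mu> i * direction L i $ j"
  shows "\<exists>I c. finite I \<and> I \<noteq> {} \<and> (\<forall>t. run L \<mu> j t = (MIN i\<in>I. e i * t + c i))"
proof -
  define s where "s i = inv e (\<mu> i * direction L i $ j)" for i
  have s: "\<mu> i * direction L i $ j = e (s i)" if "i \<le> nverts L" for i
    unfolding s_def by (rule f_inv_into_f[OF range[OF that], symmetric])
  show ?thesis
    unfolding run_def
    by (rule concave_broken_line_minimum_of_lines[where s = s and e = e,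
          OF run_interpolates strict_mono_knot]) (fact dec s)+
qed

end

section \<open>Rational speeds\<close>

lemma common_denominator:
  fixes X :: "real set"
  assumes "finite X" "X \<subseteq> \<rat>"
  shows "\<exists>N::int. N > 0 \<and> (\<forall>x\<in>X. of_int N * x \<in> \<int>)"
  using assms
proof (induction X)
  case empty
  show ?case by (intro exI[of _ 1]) simp
next
  case (insert x X)
  then obtain N :: int where N: "N > 0" "\<forall>x\<in>X. of_int N * x \<in> \<int>" by auto
  obtain m n where mn: "n > 0" "x = of_int m / of_int n"
    using insert.prems by (meson Rats_cases' insert_subset)
  have "of_int (n * N) * x = of_int (N * m)" using mn by simp
  moreover have "of_int (n * N) * y = of_int n * (of_int N * y)" for y :: real by simp
  ultimately have "\<forall>y\<in>insert x X. of_int (n * N) * y \<in> \<int>"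
    using N(2) by (metis Ints_mult Ints_of_int insert_iff)
  then show ?case using N(1) mn(1) by (intro exI[of _ "n * N"]) auto
qed

lemma rational_direction:
  assumes "polygonal_line L" "i \<le> nverts L"
  shows "rational_vector (direction L i)"
  using assms by (auto simp: polygonal_line_def direction_def rational_vector_def)

text \<open>
  Prescribed positive rational ratios of consecutive speeds determine all speeds from the first
  one. A common denominator of the resulting slopes, used as a factor for all speeds, makes the
  slopes integers and leaves the ratios as they are.
\<close>

lemma integral_speeds:
  fixes L :: "'n::finite polyline"
  assumes L: "polygonal_line L" and \<rho>: "\<And>i. i < nverts L \<Longrightarrow> \<rho> i \<in> \<rat> \<and> \<rho> i > 0"
  obtains \<mu> where "\<And>i. \<mu> i > 0"
    and "\<And>i j. i \<le> nverts L \<Longrightarrow> \<mu> i * direction L i $ j \<in> \<int>"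
    and "\<And>i. i < nverts L \<Longrightarrow> \<mu> (i + 1) = \<rho> i * \<mu> i"
proof -
  \<comment> \<open>only finitely many ratios are prescribed; beyond them the speed is kept, so that it is positive everywhere\<close>
  define \<rho>' where "\<rho>' i = (if i < nverts L then \<rho> i else 1)" for i
  define \<nu> where "\<nu> i = (\<Prod>l<i. \<rho>' l)" for i
  have "\<rho>' i \<in> \<rat>" "\<rho>' i > 0" for i using \<rho> by (auto simp: \<rho>'_def)
  then have \<nu>: "\<nu> i \<in> \<rat>" "\<nu> i > 0" for i by (auto simp: \<nu>_def intro!: Rats_prod prod_pos)
  let ?X = "\<Union>i\<le>nverts L. range (\<lambda>j. \<nu> i * direction L i $ j)"
  have "?X \<subseteq> \<rat>"
    using \<nu>(1) rational_direction[OF L] by (auto simp: rational_vector_def)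
  then obtain N :: int where N: "N > 0" "\<forall>x\<in>?X. of_int N * x \<in> \<int>"
    using common_denominator[of ?X] by auto
  show ?thesis
  proof (rule that[of "\<lambda>i. of_int N * \<nu> i"])
    show "of_int N * \<nu> i > 0" for i using N(1) \<nu>(2) by simp
    show "of_int N * \<nu> i * direction L i $ j \<in> \<int>" if "i \<le> nverts L" for i j
      using N(2) that by (auto simp: mult.assoc)
    show "of_int N * \<nu> (i + 1) = \<rho> i * (of_int N * \<nu> i)" if "i < nverts L" for i
      using that by (simp add: \<nu>_def \<rho>'_def)
  qed
qed

lemma descending_integral_speeds:
  fixes L :: "'n::finite polyline"
  assumes L: "polygonal_line L"
    and bend: "\<And>i. i < nverts L \<Longrightarrow> concave_bend (direction L i) (direction L (i + 1))"
  obtains \<mu> where "\<And>i. \<mu> i > 0"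
    and "\<And>i j. i \<le> nverts L \<Longrightarrow> \<mu> i * direction L i $ j \<in> \<int>"
    and "\<And>i j. i < nverts L \<Longrightarrow> \<mu> (i + 1) * direction L (i + 1) $ j \<le> \<mu> i * direction L i $ j"
proof -
  have "\<exists>r. r \<in> \<rat> \<and> r > 0 \<and> (\<forall>j. r * direction L (i + 1) $ j \<le> direction L i $ j)"
    if "i < nverts L" for i
    using rational_descent_ratio[OF _ _ bend[OF that]] rational_direction[OF L] that by auto
  then obtain \<rho> where \<rho>: "\<And>i. i < nverts L \<Longrightarrow> \<rho> i \<in> \<rat> \<and> \<rho> i > 0"
    and desc: "\<And>i j. i < nverts L \<Longrightarrow> \<rho> i * direction L (i + 1) $ j \<le> direction L i $ j"
    by metis
  obtain \<mu> where \<mu>: "\<And>i. \<mu> i > 0" "\<And>i j. i \<le> nverts L \<Longrightarrow> \<mu> i * direction L i $ j \<in> \<int>"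
    and step: "\<And>i. i < nverts L \<Longrightarrow> \<mu> (i + 1) = \<rho> i * \<mu> i"
    using integral_speeds[of L \<rho>, OF L \<rho>] by blast
  have "\<mu> (i + 1) * direction L (i + 1) $ j \<le> \<mu> i * direction L i $ j" if "i < nverts L" for i j
    using mult_left_mono[OF desc[OF that] less_imp_le[OF \<mu>(1)[of i]], of j] step[OF that]
    by (simp add: mult_ac)
  with \<mu> show ?thesis using that by blast
qed

lemma ex_rational_parametrisation:
  assumes L: "polygonal_line L"
  shows "\<exists>f. tropical_rational_parametrisation L f"
proof -
  have one: "(1::real) \<in> \<rat> \<and> 1 > (0::real)" by simp
  obtain \<mu> where \<mu>: "\<And>i. \<mu> i > 0"
    and int: "\<And>i j. i \<le> nverts L \<Longrightarrow> \<mu> i * direction L i $ j \<in> \<int>"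
    by (rule integral_speeds[OF L, of "\<lambda>_. 1", OF one]) (rule that)
  from run_parametrisation[OF L \<mu> int] show ?thesis by blast
qed

lemma ex_laurent_parametrisation_iff:
  assumes L: "polygonal_line L"
  shows "(\<exists>f. tropical_laurent_parametrisation L f) \<longleftrightarrow>
    (\<forall>i<nverts L. concave_bend (direction L i) (direction L (i + 1)))"
proof
  assume "\<exists>f. tropical_laurent_parametrisation L f"
  then show "\<forall>i<nverts L. concave_bend (direction L i) (direction L (i + 1))"
    using laurent_concave_bend[OF L] by blast
next
  assume "\<forall>i<nverts L. concave_bend (direction L i) (direction L (i + 1))"
  then have bend: "concave_bend (direction L i) (direction L (i + 1))" if "i < nverts L" for i
    using that by blast
  obtain \<mu> where \<mu>: "\<And>i. \<mu> i > 0"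
    and int: "\<And>i j. i \<le> nverts L \<Longrightarrow> \<mu> i * direction L i $ j \<in> \<int>"
    and dec: "\<And>i j. i < nverts L \<Longrightarrow> \<mu> (i + 1) * direction L (i + 1) $ j \<le> \<mu> i * direction L i $ j"
    by (rule descending_integral_speeds[OF L bend], assumption) (rule that)
  have "tropical_laurent_polynomial (run L \<mu> j)" for j
    unfolding tropical_laurent_polynomial_def
  proof (rule run_minimum_of_lines[OF L \<mu>])
    show "\<mu> i * direction L i $ j \<in> range of_int" if "i \<le> nverts L" for i
      using int[OF that] by (simp add: Ints_def)
  qed (rule dec)
  then show "\<exists>f. tropical_laurent_parametrisation L f"
    using run_parametrisation[OF L \<mu> int] unfolding tropical_laurent_parametrisation_def by blast
qed

text \<open>
  Among nonnegative directions, \<open>concave_bend\<close> only says that a coordinate that vanishes on one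
  interval vanishes on the next; the remaining clauses concern negative entries.
\<close>

lemma ex_polynomial_parametrisation_iff:
  assumes L: "polygonal_line L"
  shows "(\<exists>f. tropical_polynomial_parametrisation L f) \<longleftrightarrow>
    (\<forall>i\<le>nverts L. \<forall>j. direction L i $ j \<ge> 0) \<and>
    (\<forall>i<nverts L. \<forall>j. direction L i $ j = 0 \<longrightarrow> direction L (i + 1) $ j = 0)"
    (is "_ \<longleftrightarrow> ?nonneg \<and> ?zero")
proof
  assume "\<exists>f. tropical_polynomial_parametrisation L f"
  then obtain f where f: "tropical_polynomial_parametrisation L f" ..
  then have nonneg: ?nonneg using polynomial_direction_nonneg[OF L] by blast
  have "tropical_laurent_parametrisation L f"
    using f by (simp add: tropical_polynomial_parametrisation_def
        tropical_laurent_parametrisation_def tropical_polynomial_imp_laurent)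
  then have "concave_bend (direction L i) (direction L (i + 1))" if "i < nverts L" for i
    using that by (rule laurent_concave_bend[OF L])
  then have drop: "direction L i $ j > 0" if "i < nverts L" "direction L (i + 1) $ j > 0" for i j
    using that unfolding concave_bend_def by blast
  have ?zero
  proof (intro allI impI)
    fix i j assume i: "i < nverts L" and z: "direction L i $ j = 0"
    have "direction L (i + 1) $ j \<ge> 0" using nonneg i by simp
    with drop[OF i, of j] z show "direction L (i + 1) $ j = 0" by fastforce
  qed
  with nonneg show "?nonneg \<and> ?zero" ..
next
  assume *: "?nonneg \<and> ?zero"
  have bend: "concave_bend (direction L i) (direction L (i + 1))" if "i < nverts L" for i
  proof -
    have nonneg: "direction L i $ j \<ge> 0" for j using * that by simp
    moreover have "direction L i $ j > 0" if "direction L (i + 1) $ j > 0" for j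
    proof -
      have "direction L i $ j \<noteq> 0" using * that \<open>i < nverts L\<close> by fastforce
      with nonneg[of j] show ?thesis by simp
    qed
    ultimately show ?thesis unfolding concave_bend_def by (simp add: leD)
  qed
  obtain \<mu> where \<mu>: "\<And>i. \<mu> i > 0"
    and int: "\<And>i j. i \<le> nverts L \<Longrightarrow> \<mu> i * direction L i $ j \<in> \<int>"
    and dec: "\<And>i j. i < nverts L \<Longrightarrow> \<mu> (i + 1) * direction L (i + 1) $ j \<le> \<mu> i * direction L i $ j"
    by (rule descending_integral_speeds[OF L bend], assumption) (rule that)
  have "\<mu> i * direction L i $ j \<in> range (of_nat :: nat \<Rightarrow> real)" if "i \<le> nverts L" for i j
  proof -
    have "\<mu> i * direction L i $ j \<ge> 0" using * that \<mu>[of i] by simp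
    with int[OF that, of j] show ?thesis unfolding Nats_def[symmetric]
      by (auto elim!: Ints_cases simp: Nats_altdef1)
  qed
  then have "tropical_polynomial (run L \<mu> j)" for j
    unfolding tropical_polynomial_def by (rule run_minimum_of_lines[OF L \<mu> _ dec])
  then show "\<exists>f. tropical_polynomial_parametrisation L f"
    using run_parametrisation[OF L \<mu> int] unfolding tropical_polynomial_parametrisation_def by blast
qed

theorem proposition5p2:
  fixes L :: "'n::finite polyline" and a :: "nat \<Rightarrow> real ^ 'n"
  assumes "polygonal_line L" and "slope_vectors L a"
  shows "(\<exists>f. tropical_rational_parametrisation L f) \<and>
    ((\<exists>f. tropical_polynomial_parametrisation L f) \<longleftrightarrow>
      (\<forall>i\<le>nverts L. \<forall>j. a i $ j \<ge> 0 \<and>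
         (a i $ j = 0 \<longrightarrow> (\<forall>l. i \<le> l \<and> l \<le> nverts L \<longrightarrow> a l $ j = 0)))) \<and>
    ((\<exists>f. tropical_laurent_parametrisation L f) \<longleftrightarrow>
      (\<forall>i<nverts L.
         (\<forall>j. a i $ j < 0 \<longrightarrow> a (i + 1) $ j < 0) \<and>
         (\<forall>j. a (i + 1) $ j > 0 \<longrightarrow> a i $ j > 0) \<and>
         (\<forall>j j0. j \<noteq> j0 \<longrightarrow>
            a i $ j0 > 0 \<and> a (i + 1) $ j0 > 0 \<and> a i $ j < 0 \<and> a (i + 1) $ j < 0 \<longrightarrow>
            a i $ j0 / a i $ j \<le> a (i + 1) $ j0 / a (i + 1) $ j)))"
proof -
  let ?k = "nverts L" and ?d = "direction L"
  obtain c where c: "\<And>i. i \<le> ?k \<Longrightarrow> c i > 0 \<and> a i = c i *\<^sub>R ?d i"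
    using assms(2) unfolding slope_vectors_def by metis
  have bend: "concave_bend (a i) (a (i + 1)) \<longleftrightarrow> concave_bend (?d i) (?d (i + 1))" if "i < ?k" for i
    using c[of i] c[of "i + 1"] that by (simp add: concave_bend_scale)
  have nonneg: "a i $ j \<ge> 0 \<longleftrightarrow> ?d i $ j \<ge> 0" and zero: "a i $ j = 0 \<longleftrightarrow> ?d i $ j = 0"
    if "i \<le> ?k" for i j
    using c[OF that] by (auto simp: zero_le_mult_iff)
  \<comment> \<open>persistence of zeros from one interval to the next is the same as persistence to all later ones\<close>
  have "(\<forall>i<?k. \<forall>j. ?d i $ j = 0 \<longrightarrow> ?d (i + 1) $ j = 0) \<longleftrightarrow>
      (\<forall>i\<le>?k. \<forall>j. ?d i $ j = 0 \<longrightarrow> (\<forall>l. i \<le> l \<and> l \<le> ?k \<longrightarrow> ?d l $ j = 0))"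
  proof (intro iffI allI impI)
    fix i j l
    assume step: "\<forall>i<?k. \<forall>j. ?d i $ j = 0 \<longrightarrow> ?d (i + 1) $ j = 0" and "?d i $ j = 0"
    assume "i \<le> l \<and> l \<le> ?k"
    then have "i \<le> l" "l \<le> ?k" by auto
    then show "?d l $ j = 0"
      by (induction l rule: dec_induct) (use step \<open>?d i $ j = 0\<close> in auto)
  next
    fix i j
    assume all: "\<forall>i\<le>?k. \<forall>j. ?d i $ j = 0 \<longrightarrow> (\<forall>l. i \<le> l \<and> l \<le> ?k \<longrightarrow> ?d l $ j = 0)"
      and i: "i < ?k" "?d i $ j = 0"
    show "?d (i + 1) $ j = 0" using all[rule_format, of i j "i + 1"] i by simp
  qed
  then have "(\<exists>f. tropical_polynomial_parametrisation L f) \<longleftrightarrow>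
      (\<forall>i\<le>?k. \<forall>j. ?d i $ j \<ge> 0 \<and> (?d i $ j = 0 \<longrightarrow> (\<forall>l. i \<le> l \<and> l \<le> ?k \<longrightarrow> ?d l $ j = 0)))"
    unfolding ex_polynomial_parametrisation_iff[OF assms(1)] by blast
  also have "\<dots> \<longleftrightarrow>
      (\<forall>i\<le>?k. \<forall>j. a i $ j \<ge> 0 \<and> (a i $ j = 0 \<longrightarrow> (\<forall>l. i \<le> l \<and> l \<le> ?k \<longrightarrow> a l $ j = 0)))"
    by (simp add: nonneg zero)
  finally have "(\<exists>f. tropical_polynomial_parametrisation L f) \<longleftrightarrow> \<dots>" .
  moreover have "(\<exists>f. tropical_laurent_parametrisation L f) \<longleftrightarrow>
      (\<forall>i<?k. concave_bend (a i) (a (i + 1)))"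
    unfolding ex_laurent_parametrisation_iff[OF assms(1)] using bend by simp
  ultimately show ?thesis
    using ex_rational_parametrisation[OF assms(1)] unfolding concave_bend_def by blast
qed

end
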